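(* Let $k\ge 1$ be an integer. Every $K_4$-minor-free $2k$-graph is $2k$-edge-colorable, that is, its edges can be colored with $2k$ colors so that any two distinct edges sharing an endpoint receive different colors.
   Context: Multigraphs are finite and may have parallel edges but no loops. A $2k$-graph is a $2k$-regular multigraph $G$ such that for every set $X\subseteq V(G)$ with $|X|$ odd, at least $2k$ edges of $G$ have exactly one endpoint in $X$. A multigraph is $K_4$-minor-free if $K_4$ cannot be obtained from it by deleting edges or vertices and contracting edges. *)

theory Defs
  imports Main
begin

record ('v, 'e) multigraph =
  vertices :: "'v set"
  edges :: "'e set"
  endpoints :: "'e \<Rightarrow> 'v set"

definition is_multigraph :: "('v, 'e) multigraph \<Rightarrow> bool" where
  "is_multigraph G \<longleftrightarrow>
     finite (vertices G) \<and> finite (edges G) \<and>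
     (\<forall>e \<in> edges G. endpoints G e \<subseteq> vertices G \<and> card (endpoints G e) = 2)"

definition degree :: "('v, 'e) multigraph \<Rightarrow> 'v \<Rightarrow> nat" where
  "degree G v = card {e \<in> edges G. v \<in> endpoints G e}"

definition regular :: "nat \<Rightarrow> ('v, 'e) multigraph \<Rightarrow> bool" where
  "regular r G \<longleftrightarrow> (\<forall>v \<in> vertices G. degree G v = r)"

definition boundary :: "('v, 'e) multigraph \<Rightarrow> 'v set \<Rightarrow> 'e set" where
  "boundary G X = {e \<in> edges G. card (endpoints G e \<inter> X) = 1}"

definition r_graph :: "nat \<Rightarrow> ('v, 'e) multigraph \<Rightarrow> bool" where
  "r_graph r G \<longleftrightarrow>
     is_multigraph G \<and> regular r G \<and>
     (\<forall>X. X \<subseteq> vertices G \<and> odd (card X) \<longrightarrow> r \<le> card (boundary G X))"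

definition delete_edge :: "('v, 'e) multigraph \<Rightarrow> 'e \<Rightarrow> ('v, 'e) multigraph" where
  "delete_edge G e = G\<lparr>edges := edges G - {e}\<rparr>"

definition delete_vertex :: "('v, 'e) multigraph \<Rightarrow> 'v \<Rightarrow> ('v, 'e) multigraph" where
  "delete_vertex G v =
     G\<lparr>vertices := vertices G - {v}, edges := {e \<in> edges G. v \<notin> endpoints G e}\<rparr>"

text \<open>Contraction of an edge with endpoints \<open>u\<close> and \<open>v\<close>: \<open>v\<close> is identified
  with \<open>u\<close>. The edges between \<open>u\<close> and \<open>v\<close>, which would become loops, are removed;
  parallel edges that arise are kept.\<close>

definition identify :: "('v, 'e) multigraph \<Rightarrow> 'v \<Rightarrow> 'v \<Rightarrow> ('v, 'e) multigraph" where
  "identify G u v =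
     \<lparr>vertices = vertices G - {v},
      edges = {e \<in> edges G. endpoints G e \<noteq> {u, v}},
      endpoints = (\<lambda>e. (\<lambda>x. if x = v then u else x) ` endpoints G e)\<rparr>"

inductive minor_step :: "('v, 'e) multigraph \<Rightarrow> ('v, 'e) multigraph \<Rightarrow> bool" where
  delete_edge: "e \<in> edges G \<Longrightarrow> minor_step G (delete_edge G e)"
| delete_vertex: "v \<in> vertices G \<Longrightarrow> minor_step G (delete_vertex G v)"
| contract_edge: "e \<in> edges G \<Longrightarrow> endpoints G e = {u, v} \<Longrightarrow> u \<noteq> v
    \<Longrightarrow> minor_step G (identify G u v)"

lemma minor_step_is_multigraph:
  assumes "minor_step G H" "is_multigraph G"
  shows "is_multigraph H"
  using assms
proof cases
  case (contract_edge e u v)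
  let ?f = "\<lambda>x. if x = v then u else x"
  have "?f ` endpoints G d \<subseteq> vertices G - {v} \<and> card (?f ` endpoints G d) = 2"
    if d: "d \<in> edges G" "endpoints G d \<noteq> {u, v}" for d
  proof -
    have sub: "endpoints G d \<subseteq> vertices G" and "card (endpoints G d) = 2"
      using assms(2) d(1) by (auto simp: is_multigraph_def)
    then obtain a b where ab: "endpoints G d = {a, b}" "a \<noteq> b"
      by (meson card_2_iff)
    have u: "u \<in> vertices G"
      using assms(2) contract_edge(2,3) unfolding is_multigraph_def by blast
    have ne: "?f a \<noteq> ?f b"
      using ab d(2) by (metis insert_commute)
    have img: "?f ` endpoints G d = {?f a, ?f b}"
      using ab(1) by simp
    have "{?f a, ?f b} \<subseteq> vertices G - {v}"
      using sub u ab(1) contract_edge(4) by simp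
    moreover have "card {?f a, ?f b} = 2"
      using ne by (rule card_2_iff[THEN iffD2, OF exI, OF exI, OF conjI, OF refl])
    ultimately show ?thesis
      unfolding img by (rule conjI)
  qed
  moreover have "finite (vertices G)" "finite (edges G)"
    using assms(2) unfolding is_multigraph_def by blast+
  ultimately show ?thesis
    unfolding contract_edge(1) is_multigraph_def identify_def by simp
qed (auto simp: is_multigraph_def delete_edge_def delete_vertex_def)

definition is_K4 :: "('v, 'e) multigraph \<Rightarrow> bool" where
  "is_K4 H \<longleftrightarrow>
     card (vertices H) = 4 \<and>
     bij_betw (endpoints H) (edges H) {S. S \<subseteq> vertices H \<and> card S = 2}"

definition K4_minor_free :: "('v, 'e) multigraph \<Rightarrow> bool" where
  "K4_minor_free G \<longleftrightarrow> \<not> (\<exists>H. minor_step\<^sup>*\<^sup>* G H \<and> is_K4 H)"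

definition edge_colorable :: "nat \<Rightarrow> ('v, 'e) multigraph \<Rightarrow> bool" where
  "edge_colorable n G \<longleftrightarrow>
     (\<exists>c :: 'e \<Rightarrow> nat.
        (\<forall>e \<in> edges G. c e < n) \<and>
        (\<forall>e \<in> edges G. \<forall>f \<in> edges G.
           e \<noteq> f \<and> endpoints G e \<inter> endpoints G f \<noteq> {} \<longrightarrow> c e \<noteq> c f))"

end

theory Submission
  imports Defs
begin

text \<open>
  The theorem holds for \<open>r\<close>-graphs with any \<open>r \<ge> 1\<close>, by induction on the number of vertices.
  Two facts carry it.

  The first is structural: a nonempty graph in which every vertex has at least three distinct
  neighbours has a \<open>K\<^sub>4\<close>-minor (lemma \<open>min_degree_3_K4_minor\<close>). So a nonempty
  \<open>K\<^sub>4\<close>-minor-free \<open>r\<close>-graph has a vertex \<open>v\<close> with one or two neighbours; it has at least one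
  because its degree \<open>r\<close> is positive.

  The second is that such a vertex is always reducible. If \<open>a\<close> is the only neighbour of \<open>v\<close>, then all
  \<open>r\<close> edges at \<open>v\<close> and all \<open>r\<close> edges at \<open>a\<close> join \<open>v\<close> to \<open>a\<close>; this pair is a component, which is
  removed and coloured separately. If \<open>v\<close> has exactly the neighbours \<open>a\<close> and \<open>b\<close>, let \<open>A\<close> and \<open>B\<close>
  be the edges at \<open>a\<close> and at \<open>b\<close> that avoid \<open>v\<close>. Counting degrees gives \<open>|A| + |B| = r\<close>, and the
  boundary of the odd set \<open>{v, a, b}\<close> is the symmetric difference of \<open>A\<close> and \<open>B\<close>. It has at least \<open>r\<close>
  elements, so \<open>A\<close> and \<open>B\<close> are disjoint: \<open>a\<close> and \<open>b\<close> are not adjacent, and the boundary has exactly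
  \<open>r\<close> edges. Contracting \<open>{v, a, b}\<close> to one vertex yields a smaller \<open>r\<close>-graph, which is a minor
  since \<open>v\<close> is adjacent to both \<open>a\<close> and \<open>b\<close>. In a colouring of it the edges of \<open>A \<union> B\<close> have
  pairwise different colours. There are exactly \<open>|B|\<close> edges between \<open>v\<close> and \<open>a\<close>, and
  these take the colours of \<open>B\<close>; likewise the edges between \<open>v\<close> and \<open>b\<close> take the colours of \<open>A\<close>.

  The structural fact is proved by contractions alone. In a graph with at least three neighbours at
  each vertex, contracting an edge \<open>xy\<close> lowers the number of neighbours only at
  the common neighbours of \<open>x\<close> and \<open>y\<close>, by one, and at the merged vertex, which still has at least
  three if \<open>x\<close> and \<open>y\<close> have at most one common neighbour. So in a minimal
  counterexample every edge lies in at least two triangles, or in exactly one, whose third vertex has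
  three neighbours. The latter kind forces two adjacent vertices \<open>x\<close>, \<open>z\<close> of degree three with the
  same two further neighbours \<open>y\<close>, \<open>w\<close>, where \<open>y\<close> and \<open>w\<close> are not adjacent; replacing \<open>x\<close> and \<open>z\<close> by
  an edge \<open>yw\<close> gives a smaller counterexample. If every edge lies in two triangles, then a closed
  neighbourhood induces a graph that again satisfies the degree hypothesis, so by minimality it is the
  whole graph. Hence the graph is complete on at least four vertices.
\<close>

section \<open>Neighbours and minors\<close>

definition nbrs :: "('v, 'e) multigraph \<Rightarrow> 'v \<Rightarrow> 'v set" where
  "nbrs G x = {y. \<exists>e \<in> edges G. endpoints G e = {x, y}}"

lemma nbrs_sym: "y \<in> nbrs G x \<longleftrightarrow> x \<in> nbrs G y"
  by (auto simp: nbrs_def insert_commute)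

lemma nbrs_irrefl: "is_multigraph G \<Longrightarrow> x \<notin> nbrs G x"
  by (fastforce simp: nbrs_def is_multigraph_def)

lemma nbrs_subset: "is_multigraph G \<Longrightarrow> nbrs G x \<subseteq> vertices G"
  by (fastforce simp: nbrs_def is_multigraph_def)

lemma finite_nbrs: "is_multigraph G \<Longrightarrow> finite (nbrs G x)"
  by (meson finite_subset is_multigraph_def nbrs_subset)

lemma edge_at:
  assumes "is_multigraph G" "e \<in> edges G" "x \<in> endpoints G e"
  obtains y where "endpoints G e = {x, y}" "y \<noteq> x" "y \<in> nbrs G x"
proof -
  have "card (endpoints G e) = 2" using assms by (auto simp: is_multigraph_def)
  then obtain s t where "endpoints G e = {s, t}" "s \<noteq> t" by (auto simp: card_2_iff)
  then obtain y where "endpoints G e = {x, y}" "y \<noteq> x"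
    using assms(3) by (cases "x = s") (auto simp: insert_commute)
  then show ?thesis using that assms(2) by (auto simp: nbrs_def)
qed

lemma minor_is_multigraph:
  assumes "minor_step\<^sup>*\<^sup>* G H" "is_multigraph G"
  shows "is_multigraph H"
  using assms by (induction rule: rtranclp_induct) (auto intro: minor_step_is_multigraph)

lemma K4_minor_free_minor:
  "K4_minor_free G \<Longrightarrow> minor_step\<^sup>*\<^sup>* G H \<Longrightarrow> K4_minor_free H"
  unfolding K4_minor_free_def by (meson rtranclp_trans)

lemma minor_step_identify:
  assumes "is_multigraph G" "v \<in> nbrs G u"
  shows "minor_step G (identify G u v)"
  using assms nbrs_irrefl[OF assms(1)] by (auto simp: nbrs_def intro: minor_step.contract_edge)

lemma vertices_identify [simp]: "vertices (identify G u v) = vertices G - {v}"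
  by (simp add: identify_def)

lemma nbrs_identify_merged:
  assumes G: "is_multigraph G" and uv: "u \<noteq> v"
  shows "nbrs (identify G u v) u = (nbrs G u \<union> nbrs G v) - {u, v}" (is "?L = ?R")
proof
  show "?L \<subseteq> ?R"
  proof
    fix y assume "y \<in> ?L"
    then obtain e where e: "e \<in> edges G" "endpoints G e \<noteq> {u, v}"
      "(\<lambda>x. if x = v then u else x) ` endpoints G e = {u, y}"
      by (auto simp: nbrs_def identify_def)
    have "card (endpoints G e) = 2" using G e(1) by (auto simp: is_multigraph_def)
    then obtain s t where st: "endpoints G e = {s, t}" "s \<noteq> t" by (auto simp: card_2_iff)
    have *: "t \<in> nbrs G s" "s \<in> nbrs G t"
      using e(1) st by (auto simp: nbrs_def insert_commute)
    show "y \<in> ?R"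
      using e(2,3) st uv * by (auto simp: doubleton_eq_iff split: if_splits)
  qed
next
  show "?R \<subseteq> ?L"
  proof
    fix y assume y: "y \<in> ?R"
    then obtain e where e: "e \<in> edges G" "endpoints G e = {u, y} \<or> endpoints G e = {v, y}"
      by (auto simp: nbrs_def)
    then show "y \<in> ?L"
      using y uv by (auto simp: nbrs_def identify_def doubleton_eq_iff intro!: bexI[of _ e])
  qed
qed

lemma nbrs_identify_other:
  assumes G: "is_multigraph G" and uv: "u \<noteq> v" and x: "x \<noteq> u" "x \<noteq> v"
  shows "nbrs (identify G u v) x =
    (if v \<in> nbrs G x then insert u (nbrs G x - {v}) else nbrs G x)" (is "?L = ?R")
proof
  show "?L \<subseteq> ?R"
  proof
    fix y assume "y \<in> ?L"
    then obtain e where e: "e \<in> edges G"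
      and im: "(\<lambda>x. if x = v then u else x) ` endpoints G e = {x, y}"
      by (auto simp: nbrs_def identify_def)
    have "x \<in> (\<lambda>x. if x = v then u else x) ` endpoints G e" using im by simp
    then have "x \<in> endpoints G e" using x by (auto split: if_splits)
    then obtain q where q: "endpoints G e = {x, q}" "q \<in> nbrs G x"
      using edge_at[OF G e] by blast
    have "{x, if q = v then u else q} = {x, y}" using im x unfolding q(1) by (simp del: if_image_distrib)
    then have "y = (if q = v then u else q)" by (auto simp: doubleton_eq_iff)
    then show "y \<in> ?R" using q(2) by auto
  qed
next
  show "?R \<subseteq> ?L"
  proof
    fix y assume y: "y \<in> ?R"
    show "y \<in> ?L"
    proof (cases "y = u \<and> v \<in> nbrs G x")
      case True
      then obtain e where "e \<in> edges G" "endpoints G e = {x, v}" by (auto simp: nbrs_def)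
      then show ?thesis
        using True x by (auto simp: nbrs_def identify_def doubleton_eq_iff intro!: bexI[of _ e])
    next
      case False
      then have "y \<in> nbrs G x" "y \<noteq> v" using y by (auto split: if_splits)
      then obtain e where "e \<in> edges G" "endpoints G e = {x, y}" by (auto simp: nbrs_def)
      then show ?thesis
        using \<open>y \<noteq> v\<close> x by (auto simp: nbrs_def identify_def doubleton_eq_iff intro!: bexI[of _ e])
    qed
  qed
qed

text \<open>A third vertex loses a neighbour only if two of its neighbours become one.\<close>

lemma card_nbrs_identify_other:
  assumes G: "is_multigraph G" and uv: "u \<noteq> v" and x: "x \<noteq> u" "x \<noteq> v"
  shows "card (nbrs G x) \<le> card (nbrs (identify G u v) x) + (if x \<in> nbrs G u \<inter> nbrs G v then 1 else 0)"
proof (cases "v \<in> nbrs G x")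
  case False
  then show ?thesis using nbrs_identify_other[OF assms] by simp
next
  case True
  have fin: "finite (nbrs G x)" using finite_nbrs[OF G] .
  have "x \<in> nbrs G v" using True by (simp add: nbrs_sym)
  moreover have "u \<in> nbrs G x \<longleftrightarrow> x \<in> nbrs G u" by (rule nbrs_sym)
  moreover have "card (nbrs G x) = Suc (card (nbrs G x - {v}))"
    using True fin by (metis card.remove)
  ultimately show ?thesis
    using True fin uv nbrs_identify_other[OF assms] by (auto simp: card_insert_if)
qed

lemma induced_subgraph_minor:
  assumes "is_multigraph G" "W \<subseteq> vertices G"
  shows "\<exists>H. minor_step\<^sup>*\<^sup>* G H \<and> vertices H = W \<and> (\<forall>x \<in> W. nbrs H x = nbrs G x \<inter> W)"
  using assms
proof (induction "card (vertices G - W)" arbitrary: G)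
  case 0
  then have "vertices G = W" by (auto simp: is_multigraph_def)
  then show ?case using nbrs_subset[OF 0(2)] by (intro exI[of _ G]) auto
next
  case (Suc n)
  then obtain v where v: "v \<in> vertices G" "v \<notin> W"
    by (metis Diff_iff card.empty ex_in_conv nat.distinct(1))
  let ?G = "delete_vertex G v"
  have step: "minor_step G ?G" using v by (intro minor_step.delete_vertex)
  have "vertices ?G - W = (vertices G - W) - {v}" by (auto simp: delete_vertex_def)
  then have "n = card (vertices ?G - W)" using Suc(2) v by simp
  moreover have "is_multigraph ?G" using step Suc(3) by (rule minor_step_is_multigraph)
  moreover have "W \<subseteq> vertices ?G" using Suc(4) v by (auto simp: delete_vertex_def)
  ultimately obtain H where H: "minor_step\<^sup>*\<^sup>* ?G H" "vertices H = W"
    "\<forall>x \<in> W. nbrs H x = nbrs ?G x \<inter> W" using Suc(1) by blast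
  have "nbrs ?G x \<inter> W = nbrs G x \<inter> W" if "x \<in> W" for x
    using that v by (auto simp: nbrs_def delete_vertex_def)
  with H step show ?case by (metis converse_rtranclp_into_rtranclp)
qed

text \<open>The definition of \<open>K\<^sub>4\<close> allows no parallel edges, so surplus edges are deleted one at a
  time; this does not change who is adjacent to whom.\<close>

lemma complete4_not_K4_minor_free:
  assumes "is_multigraph G" "card (vertices G) = 4"
    "\<And>x y. x \<in> vertices G \<Longrightarrow> y \<in> vertices G \<Longrightarrow> x \<noteq> y \<Longrightarrow> y \<in> nbrs G x"
  shows "\<not> K4_minor_free G"
  using assms
proof (induction "card (edges G)" arbitrary: G rule: less_induct)
  case less
  show ?case
  proof (cases "inj_on (endpoints G) (edges G)")
    case True
    have "endpoints G ` edges G = {S. S \<subseteq> vertices G \<and> card S = 2}"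
    proof
      show "endpoints G ` edges G \<subseteq> {S. S \<subseteq> vertices G \<and> card S = 2}"
        using less.prems(1) by (auto simp: is_multigraph_def)
    next
      show "{S. S \<subseteq> vertices G \<and> card S = 2} \<subseteq> endpoints G ` edges G"
      proof
        fix S assume "S \<in> {S. S \<subseteq> vertices G \<and> card S = 2}"
        then obtain x y where "S = {x, y}" "x \<noteq> y" "x \<in> vertices G" "y \<in> vertices G"
          by (auto simp: card_2_iff)
        then show "S \<in> endpoints G ` edges G"
          using less.prems(3)[of x y] by (auto simp: nbrs_def)
      qed
    qed
    then have "is_K4 G" using True less.prems(2) by (simp add: is_K4_def bij_betw_def)
    then show ?thesis by (auto simp: K4_minor_free_def)
  next
    case False
    then obtain e f where ef: "e \<in> edges G" "f \<in> edges G" "e \<noteq> f" "endpoints G e = endpoints G f"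
      by (auto simp: inj_on_def)
    let ?G = "delete_edge G e"
    have step: "minor_step G ?G" using ef(1) by (rule minor_step.delete_edge)
    have fin: "finite (edges G)" using less.prems(1) by (auto simp: is_multigraph_def)
    have nb: "nbrs ?G x = nbrs G x" for x
      using ef by (auto simp: nbrs_def delete_edge_def)
    have "\<not> K4_minor_free ?G"
    proof (rule less.hyps)
      show "card (edges ?G) < card (edges G)"
        using card_Diff1_less[OF fin ef(1)] by (simp add: delete_edge_def)
      show "is_multigraph ?G" using step less.prems(1) by (rule minor_step_is_multigraph)
      show "card (vertices ?G) = 4" using less.prems(2) by (simp add: delete_edge_def)
      show "y \<in> nbrs ?G x" if "x \<in> vertices ?G" "y \<in> vertices ?G" "x \<noteq> y" for x y
        using that less.prems(3) nb by (simp add: delete_edge_def)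
    qed
    then show ?thesis using step K4_minor_free_minor by blast
  qed
qed

section \<open>Three neighbours at every vertex force a \<open>K\<^sub>4\<close>-minor\<close>

text \<open>The merged vertex has \<open>|N(x) \<union> N(y)| - 2\<close> neighbours, which is at least \<open>3 + 3 - 1 - 2\<close>.\<close>

lemma min_degree_identify:
  assumes G: "is_multigraph G" and xy: "y \<in> nbrs G x"
    and deg: "\<And>v. v \<in> vertices G \<Longrightarrow> 3 \<le> card (nbrs G v)"
    and C: "card (nbrs G x \<inter> nbrs G y) \<le> 1"
    and big: "\<And>z. z \<in> nbrs G x \<inter> nbrs G y \<Longrightarrow> 4 \<le> card (nbrs G z)"
    and w: "w \<in> vertices (identify G x y)"
  shows "3 \<le> card (nbrs (identify G x y) w)"
proof -
  have ne: "x \<noteq> y" using xy nbrs_irrefl[OF G] by auto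
  have yx: "x \<in> nbrs G y" using xy by (simp add: nbrs_sym)
  have V: "x \<in> vertices G" "y \<in> vertices G"
    using xy yx nbrs_subset[OF G] by auto
  show ?thesis
  proof (cases "w = x")
    case True
    have "card (nbrs G x) + card (nbrs G y) = card (nbrs G x \<union> nbrs G y) + card (nbrs G x \<inter> nbrs G y)"
      by (intro card_Un_Int finite_nbrs[OF G])
    moreover have "card ((nbrs G x \<union> nbrs G y) - {x, y}) = card (nbrs G x \<union> nbrs G y) - card {x, y}"
      by (rule card_Diff_subset) (use xy yx in auto)
    moreover have "card {x, y} = 2" using ne by simp
    ultimately show ?thesis
      using nbrs_identify_merged[OF G ne] True C deg[OF V(1)] deg[OF V(2)] by simp
  next
    case False
    then have "w \<in> vertices G" "w \<noteq> y" using w by auto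
    then show ?thesis
      using card_nbrs_identify_other[OF G ne False] deg[of w] big[of w] by (auto split: if_splits)
  qed
qed

lemma card_3_obtain:
  assumes "card A = 3" "a \<in> A" "b \<in> A" "a \<noteq> b"
  obtains c where "A = {a, b, c}" "c \<noteq> a" "c \<noteq> b"
proof -
  have "finite A" using assms(1) by (metis card.infinite zero_neq_numeral)
  then have "card (A - {a, b}) = 1" using assms by (simp add: card_Diff_subset)
  then obtain c where "A - {a, b} = {c}" by (auto simp: card_1_singleton_iff)
  then show ?thesis using that[of c] assms(2,3) by auto
qed

text \<open>The twins \<open>x\<close> and \<open>z\<close> form a triangle with each of the nonadjacent vertices \<open>y\<close> and \<open>w\<close>.
  Contracting a single edge of this diamond leaves a vertex with only two neighbours.
  Contracting both twins into \<open>y\<close> replaces them by an edge \<open>yw\<close>, so \<open>y\<close> and \<open>w\<close> each lose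
  two neighbours and gain one. This is harmless because each has at least four: an edge from \<open>y\<close> to
  a third neighbour \<open>u\<close> lies in a triangle, and its third vertex is not a twin, since
  the twins are not adjacent to \<open>u\<close>.\<close>

lemma diamond_identify:
  assumes G: "is_multigraph G"
    and deg: "\<And>v. v \<in> vertices G \<Longrightarrow> 3 \<le> card (nbrs G v)"
    and tri: "\<And>a b. b \<in> nbrs G a \<Longrightarrow> nbrs G a \<inter> nbrs G b \<noteq> {}"
    and Nx: "nbrs G x = {y, z, w}" and Nz: "nbrs G z = {x, y, w}"
    and yw: "w \<notin> nbrs G y" and ne: "y \<noteq> w"
  shows "\<exists>H. minor_step\<^sup>*\<^sup>* G H \<and> vertices H = vertices G - {x, z} \<and>
    (\<forall>v \<in> vertices H. 3 \<le> card (nbrs H v)) \<and> y \<in> vertices H"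
proof -
  have irr: "v \<notin> nbrs G v" for v using nbrs_irrefl[OF G] .
  have ne': "x \<noteq> y" "x \<noteq> z" "x \<noteq> w" "z \<noteq> y" "z \<noteq> w"
    using irr[of x] irr[of z] Nx Nz by auto
  have inN: "x \<in> nbrs G y" "z \<in> nbrs G y" "x \<in> nbrs G w" "z \<in> nbrs G w"
    using Nx Nz nbrs_sym[of _ G] by auto
  have only: "v \<in> {y, z, w}" if "x \<in> nbrs G v" for v using that Nx nbrs_sym[of v G x] by auto
  have only': "v \<in> {x, y, w}" if "z \<in> nbrs G v" for v using that Nz nbrs_sym[of v G z] by auto
  have four: "4 \<le> card (nbrs G p)" if p: "p \<in> {y, w}" for p
  proof (rule ccontr)
    assume "\<not> 4 \<le> card (nbrs G p)"
    moreover have "p \<in> vertices G" using p Nx nbrs_subset[OF G, of x] by auto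
    ultimately have "card (nbrs G p) = 3" using deg[of p] by linarith
    then obtain u where u: "nbrs G p = {x, z, u}" "u \<noteq> x" "u \<noteq> z"
      using card_3_obtain[of "nbrs G p" x z] p inN ne' by blast
    then have "u \<noteq> p" using irr[of p] by auto
    have "u \<notin> {y, w}"
      using u(1) \<open>u \<noteq> p\<close> p yw nbrs_sym[of w G y] by auto
    moreover have "x \<in> nbrs G u \<or> z \<in> nbrs G u"
      using tri[of u p] u irr[of u] by auto
    ultimately show False using only only' u by blast
  qed
  let ?G1 = "identify G y x"
  have s1: "minor_step G ?G1" using inN by (intro minor_step_identify G)
  have G1: "is_multigraph ?G1" using s1 G by (rule minor_step_is_multigraph)
  have y1: "nbrs ?G1 y = insert w (nbrs G y - {x})"
    using nbrs_identify_merged[OF G, of y x] ne ne' Nx irr[of y] inN by auto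
  have z1: "nbrs ?G1 z = {y, w}"
    using nbrs_identify_other[OF G, of y x z] ne ne' Nz by auto
  have w1: "nbrs ?G1 w = insert y (nbrs G w - {x})"
    using nbrs_identify_other[OF G, of y x w] ne ne' inN by auto
  have o1: "nbrs ?G1 u = nbrs G u" if "u \<notin> {x, y, z, w}" for u
    using nbrs_identify_other[OF G, of y x u] ne ne' that only[of u] by auto
  let ?H = "identify ?G1 y z"
  have s2: "minor_step ?G1 ?H"
    using inN y1 ne' by (intro minor_step_identify G1) auto
  have y2: "nbrs ?H y = insert w (nbrs G y - {x, z})"
    using nbrs_identify_merged[OF G1, of y z] ne ne' y1 z1 irr[of y] by auto
  have w2: "nbrs ?H w = insert y (nbrs G w - {x, z})"
    using nbrs_identify_other[OF G1, of y z w] ne ne' w1 inN by auto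
  have o2: "nbrs ?H u = nbrs G u" if "u \<notin> {x, y, z, w}" for u
    using nbrs_identify_other[OF G1, of y z u] ne ne' that o1[of u] only'[of u] by auto
  have fin: "finite (nbrs G v)" for v using finite_nbrs[OF G] .
  have "3 \<le> card (nbrs ?H v)" if v: "v \<in> vertices ?H" for v
  proof -
    have two: "card (nbrs G p - {x, z}) \<ge> 2" if "p \<in> {y, w}" for p
      using four[OF that] that inN ne' by (auto simp: card_Diff_subset)
    have wy: "y \<notin> nbrs G w" using yw nbrs_sym[of y G w] by simp
    consider "v = y" | "v = w" | "v \<notin> {x, y, z, w}" "v \<in> vertices G" using v by auto
    then show ?thesis
    proof cases
      case 1
      then show ?thesis using y2 two[of y] yw fin[of y] by simp
    next
      case 2
      then show ?thesis using w2 two[of w] wy fin[of w] by simp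
    next
      case 3
      then show ?thesis using o2[of v] deg[of v] by simp
    qed
  qed
  moreover have "vertices ?H = vertices G - {x, z}" by auto
  moreover have "y \<in> vertices ?H"
    using ne' Nx nbrs_subset[OF G, of x] by auto
  moreover have "minor_step\<^sup>*\<^sup>* G ?H" using s1 s2 by auto
  ultimately show ?thesis by blast
qed

text \<open>A minimal counterexample can be neither contracted (facts \<open>edge\<close>, \<open>no_diamond\<close>) nor restricted to a
  closed neighbourhood (fact \<open>complete\<close>), and therefore contains a complete graph on four vertices.\<close>

lemma min_degree_3_K4_minor:
  assumes "is_multigraph G" "vertices G \<noteq> {}"
    "\<And>v. v \<in> vertices G \<Longrightarrow> 3 \<le> card (nbrs G v)"
  shows "\<not> K4_minor_free G"
  using assms
proof (induction "card (vertices G)" arbitrary: G rule: less_induct)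
  case less
  note G = less.prems(1) and deg = less.prems(3)
  have finV: "finite (vertices G)" using G by (auto simp: is_multigraph_def)
  have irr: "v \<notin> nbrs G v" for v using nbrs_irrefl[OF G] .
  have sub: "nbrs G v \<subseteq> vertices G" for v using nbrs_subset[OF G] .
  have smaller: "\<not> K4_minor_free G"
    if "minor_step\<^sup>*\<^sup>* G H" "vertices H \<subset> vertices G" "vertices H \<noteq> {}"
      "\<And>v. v \<in> vertices H \<Longrightarrow> 3 \<le> card (nbrs H v)" for H
  proof -
    have "\<not> K4_minor_free H"
      using that minor_is_multigraph[OF that(1) G] psubset_card_mono[OF finV that(2)]
      by (intro less.hyps) auto
    then show ?thesis using K4_minor_free_minor that(1) by blast
  qed
  show ?case
  proof
    assume free: "K4_minor_free G"
    have edge: "2 \<le> card (nbrs G x \<inter> nbrs G y) \<or> (\<exists>z. nbrs G x \<inter> nbrs G y = {z} \<and> card (nbrs G z) = 3)"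
      if xy: "y \<in> nbrs G x" for x y
    proof (rule ccontr)
      assume no: "\<not> ?thesis"
      have C: "card (nbrs G x \<inter> nbrs G y) \<le> 1" using no by linarith
      have big: "4 \<le> card (nbrs G z)" if z: "z \<in> nbrs G x \<inter> nbrs G y" for z
      proof -
        have "nbrs G x \<inter> nbrs G y = {z}"
          using C z finite_nbrs[OF G, of x]
          by (metis One_nat_def card_le_Suc0_iff_eq finite_Int is_singletonI' is_singleton_the_elem singletonD emptyE)
        then have "card (nbrs G z) \<noteq> 3" using no by auto
        then show ?thesis using deg[of z] z sub[of x] by auto
      qed
      have V: "y \<in> vertices G" "x \<in> vertices G"
        using xy sub[of x] sub[of y] nbrs_sym[of x G y] by auto
      have "\<not> K4_minor_free G"
      proof (rule smaller)
        show "minor_step\<^sup>*\<^sup>* G (identify G x y)" using minor_step_identify[OF G xy] by auto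
        show "vertices (identify G x y) \<subset> vertices G" using V by auto
        show "vertices (identify G x y) \<noteq> {}" using V xy irr[of x] by auto
      qed (rule min_degree_identify[OF G xy deg C big])
      then show False using free by simp
    qed
    have tri: "nbrs G x \<inter> nbrs G y \<noteq> {}" if "y \<in> nbrs G x" for x y
      using edge[OF that] by auto
    have no_diamond: False
      if xy: "y \<in> nbrs G x" and C: "nbrs G x \<inter> nbrs G y = {z}" and Nz: "nbrs G z = {x, y, w}"
        and wx: "w \<in> nbrs G x" and wy: "w \<noteq> y" for x y z w
    proof -
      \<comment> \<open>The edge \<open>zy\<close> lies in the triangle with \<open>x\<close> only, so \<open>x\<close> has three neighbours like \<open>z\<close>.\<close>
      have zy: "y \<in> nbrs G z" using Nz by auto
      have nyw: "w \<notin> nbrs G y" using C wx Nz irr[of z] by auto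
      then have zy1: "nbrs G z \<inter> nbrs G y = {x}"
        using Nz irr[of y] xy nbrs_sym[of x G y] by auto
      then have "card (nbrs G x) = 3" using edge[OF zy] by auto
      moreover have "z \<in> nbrs G x" "y \<noteq> z" using C zy irr[of z] by auto
      ultimately obtain w' where w': "nbrs G x = {y, z, w'}"
        using card_3_obtain[of "nbrs G x" y z] xy by blast
      have "w \<noteq> z" using irr[of z] Nz by auto
      then have Nx: "nbrs G x = {y, z, w}" using w' wx wy by auto
      obtain H where H: "minor_step\<^sup>*\<^sup>* G H" "vertices H = vertices G - {x, z}"
        "\<forall>v \<in> vertices H. 3 \<le> card (nbrs H v)" "y \<in> vertices H"
        using diamond_identify[OF G deg tri Nx Nz nyw wy[symmetric]] by blast
      have "z \<in> vertices G" using Nx sub[of x] by auto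
      then have "\<not> K4_minor_free G" using H by (intro smaller[of H]) auto
      then show False using free by simp
    qed
    have two: "2 \<le> card (nbrs G x \<inter> nbrs G y)" if xy: "y \<in> nbrs G x" for x y
    proof (rule ccontr)
      assume "\<not> ?thesis"
      then obtain z where z: "nbrs G x \<inter> nbrs G y = {z}" "card (nbrs G z) = 3"
        using edge[OF xy] by auto
      have xz: "x \<in> nbrs G z" "y \<in> nbrs G z"
        using z(1) nbrs_sym[of x G z] nbrs_sym[of y G z] by auto
      have "x \<noteq> y" using xy irr[of x] by auto
      then obtain w where w: "nbrs G z = {x, y, w}" "w \<noteq> x" "w \<noteq> y"
        using card_3_obtain[OF z(2) xz] by blast
      \<comment> \<open>The edge \<open>zw\<close> lies in a triangle as well, whose third vertex is \<open>x\<close> or \<open>y\<close>.\<close>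
      have "nbrs G z \<inter> nbrs G w \<noteq> {}" using w(1) by (intro tri) auto
      then consider "w \<in> nbrs G x" | "w \<in> nbrs G y"
        using w(1) irr[of w] nbrs_sym[of w G x] nbrs_sym[of w G y] by auto
      then show False
      proof cases
        case 1
        then show ?thesis using no_diamond[OF xy z(1) w(1)] w(3) by simp
      next
        case 2
        have yx: "x \<in> nbrs G y" using xy nbrs_sym[of x G y] by simp
        have "nbrs G z = {y, x, w}" using w(1) by auto
        then show ?thesis using no_diamond[OF yx, of z w] 2 z(1) w(2) by auto
      qed
    qed
    have complete: "insert v (nbrs G v) = vertices G" if v: "v \<in> vertices G" for v
    proof (rule ccontr)
      assume no: "\<not> ?thesis"
      let ?W = "insert v (nbrs G v)"
      have W: "?W \<subset> vertices G" using no v sub[of v] by auto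
      then obtain H where H: "minor_step\<^sup>*\<^sup>* G H" "vertices H = ?W"
        "\<forall>x \<in> ?W. nbrs H x = nbrs G x \<inter> ?W"
        using induced_subgraph_minor[OF G, of ?W] by blast
      have "3 \<le> card (nbrs H x)" if x: "x \<in> ?W" for x
      proof (cases "x = v")
        case True
        then show ?thesis using H(3) deg[OF v] by (auto simp: Int_insert_right irr)
      next
        case False
        then have xv: "x \<in> nbrs G v" using x by simp
        then have "nbrs G x \<inter> ?W = insert v (nbrs G v \<inter> nbrs G x)"
          using nbrs_sym[of x G v] by auto
        moreover have "finite (nbrs G v \<inter> nbrs G x)" using finite_nbrs[OF G] by blast
        ultimately show ?thesis using H(3) x two[OF xv] irr[of v] by auto
      qed
      then have "\<not> K4_minor_free G" using H W by (intro smaller[of H]) auto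
      then show False using free by simp
    qed
    obtain v where v: "v \<in> vertices G" using less.prems(2) by auto
    have "4 \<le> card (vertices G)"
      using complete[OF v] deg[OF v] irr[of v] finite_nbrs[OF G, of v]
      by (metis Suc_le_mono card_insert_disjoint eval_nat_numeral(2) semiring_norm(26,27))
    then obtain W where W: "W \<subseteq> vertices G" "card W = 4"
      by (meson obtain_subset_with_card_n)
    obtain H where H: "minor_step\<^sup>*\<^sup>* G H" "vertices H = W"
        "\<forall>x \<in> W. nbrs H x = nbrs G x \<inter> W"
      using induced_subgraph_minor[OF G W(1)] by blast
    have "\<not> K4_minor_free H"
    proof (rule complete4_not_K4_minor_free)
      show "is_multigraph H" using minor_is_multigraph[OF H(1) G] .
      show "card (vertices H) = 4" using H W by simp
      show "y \<in> nbrs H x" if xy: "x \<in> vertices H" "y \<in> vertices H" "x \<noteq> y" for x y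
      proof -
        have "x \<in> vertices G" "y \<in> vertices G" using xy H(2) W(1) by auto
        then have "y \<in> insert x (nbrs G x)" using complete[of x] by simp
        then have "y \<in> nbrs G x" using xy(3) by simp
        then show ?thesis using H(2,3) xy by simp
      qed
    qed
    then show False using K4_minor_free_minor[OF free H(1)] by simp
  qed
qed

section \<open>Collapsing vertices and boundaries\<close>

text \<open>Let \<open>H\<close> arise from \<open>G\<close> by identifying vertices along \<open>f\<close> and dropping the edges that
  become loops. An edge lying inside a fibre of \<open>f\<close> is in no boundary of a union of fibres, and on every other
  edge \<open>f\<close> is injective, so cuts of \<open>H\<close> are exactly cuts of \<open>G\<close> along unions of fibres.\<close>

lemma boundary_collapse:
  assumes G: "is_multigraph G" and H: "is_multigraph H"
    and E: "edges H = {e \<in> edges G. card (f ` endpoints G e) \<noteq> 1}"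
    and ends: "\<And>e. e \<in> edges H \<Longrightarrow> endpoints H e = f ` endpoints G e"
  shows "boundary H X = boundary G (vertices G \<inter> f -` X)"
proof -
  have 2: "card (endpoints G e) = 2" "endpoints G e \<subseteq> vertices G" if "e \<in> edges G" for e
    using that G by (auto simp: is_multigraph_def)
  have "e \<in> boundary H X \<longleftrightarrow> e \<in> boundary G (vertices G \<inter> f -` X)" if e: "e \<in> edges G" for e
  proof -
    let ?Y = "endpoints G e \<inter> (vertices G \<inter> f -` X)"
    have Y: "f ` ?Y = f ` endpoints G e \<inter> X" using 2[OF e] by auto
    show ?thesis
    proof (cases "e \<in> edges H")
      case True
      have "card (f ` endpoints G e) = 2"
        using True ends[OF True] H by (auto simp: is_multigraph_def)
      then have "inj_on f (endpoints G e)"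
        using 2[OF e] by (metis card.infinite eq_card_imp_inj_on zero_neq_numeral)
      then have "inj_on f ?Y" by (rule inj_on_subset) auto
      then have "card (f ` endpoints G e \<inter> X) = card ?Y" using Y card_image by metis
      then show ?thesis using True e ends[OF True] by (simp add: boundary_def)
    next
      case False
      then obtain a where a: "f ` endpoints G e = {a}" using e E by (auto simp: card_1_singleton_iff)
      have "?Y = (if a \<in> X then endpoints G e else {})" using a 2[OF e] by auto
      then have "card ?Y \<noteq> 1" using 2[OF e] by auto
      then show ?thesis using False by (simp add: boundary_def)
    qed
  qed
  then show ?thesis using E by (auto simp: boundary_def)
qed

section \<open>A vertex with a single neighbour\<close>

text \<open>Every edge at \<open>v\<close> is also at \<open>a\<close>, and the two edge sets have the same size.\<close>

lemma edges_eq_if_single_nbr: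
  assumes G: "is_multigraph G" and deg: "degree G v = degree G a" and nb: "nbrs G v = {a}"
  shows "{e \<in> edges G. v \<in> endpoints G e} = {e \<in> edges G. a \<in> endpoints G e}"
proof (rule card_subset_eq)
  show "finite {e \<in> edges G. a \<in> endpoints G e}" using G by (simp add: is_multigraph_def)
  show "{e \<in> edges G. v \<in> endpoints G e} \<subseteq> {e \<in> edges G. a \<in> endpoints G e}"
  proof clarify
    fix e assume "e \<in> edges G" "v \<in> endpoints G e"
    then show "a \<in> endpoints G e" using G nb by (elim edge_at) auto
  qed
  show "card {e \<in> edges G. v \<in> endpoints G e} = card {e \<in> edges G. a \<in> endpoints G e}"
    using deg by (simp add: degree_def)
qed

lemma r_graph_delete_pair:
  assumes rG: "r_graph r G" and V: "v \<in> vertices G" "a \<in> vertices G" and nb: "nbrs G v = {a}"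
  shows "r_graph r (delete_vertex (delete_vertex G v) a)" (is "r_graph r ?H")
proof -
  have G: "is_multigraph G" using rG by (simp add: r_graph_def)
  have deg: "degree G x = r" if "x \<in> vertices G" for x
    using that rG by (simp add: r_graph_def regular_def)
  have eq: "{e \<in> edges G. v \<in> endpoints G e} = {e \<in> edges G. a \<in> endpoints G e}"
    using edges_eq_if_single_nbr[OF G _ nb] deg V by simp
  have ends: "endpoints G e = {v, a}" if e: "e \<in> edges G" "v \<in> endpoints G e \<or> a \<in> endpoints G e" for e
  proof -
    have "v \<in> endpoints G e" using e eq by blast
    then show ?thesis using edge_at[OF G e(1), of v] nb by auto
  qed
  have H: "vertices ?H = vertices G - {v, a}" "endpoints ?H = endpoints G"
    "edges ?H = {e \<in> edges G. v \<notin> endpoints G e \<and> a \<notin> endpoints G e}"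
    by (auto simp: delete_vertex_def)
  have "degree ?H x = r" if "x \<in> vertices ?H" for x
  proof -
    have "{e \<in> edges ?H. x \<in> endpoints G e} = {e \<in> edges G. x \<in> endpoints G e}"
      using that H ends by auto
    then show ?thesis using that deg[of x] H by (simp add: degree_def)
  qed
  moreover have "r \<le> card (boundary ?H X)" if X: "X \<subseteq> vertices ?H" "odd (card X)" for X
  proof -
    have "boundary ?H X = boundary G X"
    proof -
      have "e \<in> edges ?H" if "e \<in> edges G" "card (endpoints G e \<inter> X) = 1" for e
      proof (rule ccontr)
        assume "e \<notin> edges ?H"
        then have "endpoints G e = {v, a}" using ends[OF that(1)] that(1) H by auto
        then have "endpoints G e \<inter> X = {}" using X(1) H by auto
        then show False using that(2) by simp
      qed
      then show ?thesis using H by (auto simp: boundary_def)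
    qed
    then show ?thesis using rG X H by (auto simp: r_graph_def)
  qed
  moreover have "is_multigraph ?H"
    using G H by (auto simp: is_multigraph_def)
  ultimately show ?thesis by (simp add: r_graph_def regular_def)
qed

lemma edge_colorable_add_pair:
  assumes rG: "r_graph r G" and V: "v \<in> vertices G" "a \<in> vertices G" and nb: "nbrs G v = {a}"
    and col: "edge_colorable r (delete_vertex (delete_vertex G v) a)" (is "edge_colorable r ?H")
  shows "edge_colorable r G"
proof -
  have G: "is_multigraph G" using rG by (simp add: r_graph_def)
  have deg: "degree G x = r" if "x \<in> vertices G" for x
    using that rG by (simp add: r_graph_def regular_def)
  let ?P = "{e \<in> edges G. v \<in> endpoints G e}"
  have eq: "?P = {e \<in> edges G. a \<in> endpoints G e}"
    using edges_eq_if_single_nbr[OF G _ nb] deg V by simp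
  have ends: "endpoints G e = {v, a}" if e: "e \<in> ?P" for e
    using edge_at[OF G, of e v] nb e by auto
  have H: "endpoints ?H = endpoints G" "edges ?H = edges G - ?P"
    using eq by (auto simp: delete_vertex_def)
  obtain c where c: "\<forall>e \<in> edges ?H. c e < r"
    "\<forall>e \<in> edges ?H. \<forall>f \<in> edges ?H. e \<noteq> f \<and> endpoints G e \<inter> endpoints G f \<noteq> {} \<longrightarrow> c e \<noteq> (c f :: nat)"
    using col H(1) by (auto simp: edge_colorable_def)
  have "finite ?P" using G by (simp add: is_multigraph_def)
  moreover have "card ?P = card {..<r}" using deg[OF V(1)] by (simp add: degree_def)
  ultimately obtain g where "bij_betw g ?P {..<r}"
    by (meson finite_lessThan finite_same_card_bij)
  then have g: "inj_on g ?P" "\<And>e. e \<in> ?P \<Longrightarrow> g e < r" by (auto simp: bij_betw_def)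
  have apart: "endpoints G e \<inter> endpoints G f = {}" if "e \<in> ?P" "f \<in> edges G - ?P" for e f
    using ends[OF that(1)] that(2) eq by auto
  let ?c = "\<lambda>e. if e \<in> ?P then g e else c e"
  have "?c e < r" if "e \<in> edges G" for e using that c(1) g(2)[of e] H by auto
  moreover have "?c e \<noteq> ?c f"
    if ef: "e \<in> edges G" "f \<in> edges G" "e \<noteq> f" "endpoints G e \<inter> endpoints G f \<noteq> {}" for e f
  proof -
    consider "e \<in> ?P" "f \<in> ?P" | "e \<in> edges ?H" "f \<in> edges ?H"
      using apart[of e f] apart[of f e] ef H by auto
    then show ?thesis
    proof cases
      case 1
      then show ?thesis using inj_onD[OF g(1)] ef(3) by auto
    next
      case 2
      then show ?thesis using c(2) ef H by auto
    qed
  qed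
  ultimately show ?thesis unfolding edge_colorable_def by (intro exI[of _ ?c]) simp
qed

section \<open>A vertex with two neighbours\<close>

definition collapse :: "('v, 'e) multigraph \<Rightarrow> 'v \<Rightarrow> 'v \<Rightarrow> 'v \<Rightarrow> ('v, 'e) multigraph" where
  "collapse G a v b = identify (identify G a v) a b"

locale degree_two_vertex =
  fixes G :: "('v, 'e) multigraph" and r :: nat and v a b :: 'v
  assumes rG: "r_graph r G" and v: "v \<in> vertices G"
    and nb: "nbrs G v = {a, b}" and ab: "a \<noteq> b"
begin

abbreviation at :: "'v \<Rightarrow> 'e set" where "at x \<equiv> {e \<in> edges G. x \<in> endpoints G e}"

lemma G: "is_multigraph G"
  using rG by (simp add: r_graph_def)

lemma V: "a \<in> vertices G" "b \<in> vertices G"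
  using nbrs_subset[OF G, of v] nb by auto

lemma ne: "v \<noteq> a" "v \<noteq> b"
  using nbrs_irrefl[OF G, of v] nb by auto

lemma finite_at: "finite (at x)"
  using G by (simp add: is_multigraph_def)

lemma card_at: "x \<in> vertices G \<Longrightarrow> card (at x) = r"
  using rG by (simp add: r_graph_def regular_def degree_def)

lemma ends_v: "e \<in> at v \<Longrightarrow> endpoints G e = {v, a} \<or> endpoints G e = {v, b}"
  using nb edge_at[OF G, of e v] by auto

lemma at_v_split: "at v = (at v \<inter> at a) \<union> (at v \<inter> at b)" "(at v \<inter> at a) \<inter> (at v \<inter> at b) = {}"
proof -
  have "e \<in> at a \<and> e \<notin> at b \<or> e \<in> at b \<and> e \<notin> at a" if "e \<in> at v" for e
    using ends_v[OF that] that ne ab by auto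
  then show "at v = (at v \<inter> at a) \<union> (at v \<inter> at b)" "(at v \<inter> at a) \<inter> (at v \<inter> at b) = {}"
    by blast+
qed

lemma card_at_v: "card (at v \<inter> at a) + card (at v \<inter> at b) = r"
proof -
  have "card (at v) = card (at v \<inter> at a) + card (at v \<inter> at b)"
    using at_v_split finite_at by (metis (no_types, lifting) card_Un_disjoint finite_Int)
  then show ?thesis using card_at[OF v] by simp
qed

lemma card_at_split: "x \<in> vertices G \<Longrightarrow> card (at v \<inter> at x) + card (at x - at v) = r"
  using card_at[of x] card_Int_Diff[OF finite_at, of x "at v"] by (simp add: Int_commute)

text \<open>The odd cut around \<open>{v, a, b}\<close> lies in the symmetric difference of two edge sets whose sizes
  add up to \<open>r\<close>, so the bound \<open>r\<close> on odd cuts leaves no room for a common edge.\<close>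

lemma not_adjacent: "(at a - at v) \<inter> (at b - at v) = {}"
proof -
  let ?A = "at a - at v" and ?B = "at b - at v" and ?X = "{v, a, b}"
  have fin: "finite ?A" "finite ?B" using finite_at by auto
  have "boundary G ?X \<subseteq> (?A \<union> ?B) - (?A \<inter> ?B)"
  proof
    fix e assume "e \<in> boundary G ?X"
    then have e: "e \<in> edges G" "card (endpoints G e \<inter> ?X) = 1" by (auto simp: boundary_def)
    have "e \<notin> at v"
    proof
      assume "e \<in> at v"
      then have "endpoints G e \<inter> ?X = endpoints G e" using ends_v[of e] by auto
      then show False using e G by (auto simp: is_multigraph_def)
    qed
    moreover have "e \<notin> at a \<inter> at b"
    proof
      assume "e \<in> at a \<inter> at b"
      then have "{a, b} \<subseteq> endpoints G e \<inter> ?X" by auto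
      then have "card {a, b} \<le> 1" using e(2) by (metis card.infinite card_mono zero_neq_one)
      then show False using ab by simp
    qed
    moreover have "endpoints G e \<inter> ?X \<noteq> {}"
    proof
      assume "endpoints G e \<inter> ?X = {}"
      then show False using e(2) by simp
    qed
    ultimately show "e \<in> (?A \<union> ?B) - (?A \<inter> ?B)" using e(1) by blast
  qed
  then have "card (boundary G ?X) \<le> card ((?A \<union> ?B) - (?A \<inter> ?B))"
    using fin by (intro card_mono) auto
  also have "\<dots> = card (?A \<union> ?B) - card (?A \<inter> ?B)"
    using fin by (intro card_Diff_subset) auto
  finally have 1: "card (boundary G ?X) \<le> card (?A \<union> ?B) - card (?A \<inter> ?B)" .
  have "r \<le> card (boundary G ?X)"
    using rG v V ne ab by (auto simp: r_graph_def)
  moreover have "card ?A + card ?B = card (?A \<union> ?B) + card (?A \<inter> ?B)"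
    using fin by (intro card_Un_Int)
  moreover have "card ?A + card ?B = r"
    using card_at_v card_at_split[OF V(1)] card_at_split[OF V(2)] by linarith
  moreover have "card (?A \<inter> ?B) \<le> card (?A \<union> ?B)" using fin by (intro card_mono) auto
  ultimately have "card (?A \<inter> ?B) = 0" using 1 by linarith
  then show ?thesis using fin by simp
qed

text \<open>Contracting \<open>av\<close> first turns the edges between \<open>v\<close> and \<open>b\<close> into edges between \<open>a\<close> and \<open>b\<close>, so the
  second contraction is along an edge too.\<close>

abbreviation H where "H \<equiv> collapse G a v b"

abbreviation f where "f x \<equiv> (if x = v \<or> x = b then a else x)"

lemma minor_H: "minor_step\<^sup>*\<^sup>* G H"
proof -
  have "minor_step G (identify G a v)"
    using nb nbrs_sym[of v G a] by (intro minor_step_identify G) auto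
  moreover have "b \<in> nbrs (identify G a v) a"
    using nbrs_identify_merged[OF G, of a v] ne ab nb by auto
  then have "minor_step (identify G a v) H"
    unfolding collapse_def
    by (intro minor_step_identify minor_step_is_multigraph[OF calculation G])
  ultimately show ?thesis by auto
qed

lemma multigraph_H: "is_multigraph H"
  using minor_is_multigraph[OF minor_H G] .

lemma vertices_H: "vertices H = vertices G - {v, b}"
  by (auto simp: collapse_def)

lemma endpoints_H: "endpoints H e = f ` endpoints G e"
  using ne ab by (auto simp: collapse_def identify_def image_iff)

lemma edges_H: "edges H = edges G - at v"
proof -
  have "e \<in> edges H \<longleftrightarrow> e \<notin> at v" if e: "e \<in> edges G" for e
  proof (cases "e \<in> at v")
    case True
    then show ?thesis using ends_v[OF True] ne ab by (auto simp: collapse_def identify_def)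
  next
    case False
    have "endpoints G e \<noteq> {a, b}" using not_adjacent e False by auto
    moreover have "(\<lambda>x. if x = v then a else x) ` endpoints G e = endpoints G e"
      using False e by (auto simp: image_iff)
    moreover have "endpoints G e \<noteq> {a, v}" using False e by auto
    ultimately show ?thesis using e False by (simp add: collapse_def identify_def)
  qed
  then show ?thesis by (auto simp: collapse_def identify_def)
qed

text \<open>The merged vertex has the edges of the tight cut around \<open>{v, a, b}\<close>, hence degree \<open>r\<close>. An
  odd set of \<open>H\<close> pulls back to an odd set of \<open>G\<close>, since the fibre of \<open>a\<close> has three elements.\<close>

lemma r_graph_H: "r_graph r H"
proof -
  have "degree H x = r" if x: "x \<in> vertices H" for x
  proof (cases "x = a")
    case True
    have "{e \<in> edges H. a \<in> endpoints H e} = (at a - at v) \<union> (at b - at v)"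
      unfolding edges_H endpoints_H by (auto simp: image_iff split: if_splits)
    then have "degree H a = card (at a - at v) + card (at b - at v)"
      unfolding degree_def using not_adjacent finite_at by (simp add: card_Un_disjoint)
    then show ?thesis
      unfolding True using card_at_v card_at_split[OF V(1)] card_at_split[OF V(2)] by linarith
  next
    case False
    then have x: "x \<notin> {v, a, b}" "x \<in> vertices G" using x vertices_H by auto
    have "{e \<in> edges H. x \<in> endpoints H e} = at x"
      unfolding edges_H endpoints_H using x ends_v by (fastforce simp: image_iff split: if_splits)
    then show ?thesis using card_at[OF x(2)] by (simp add: degree_def)
  qed
  moreover have "r \<le> card (boundary H X)" if X: "X \<subseteq> vertices H" "odd (card X)" for X
  proof -
    have *: "edges H = {e \<in> edges G. card (f ` endpoints G e) \<noteq> 1}"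
    proof -
      have "card (f ` endpoints G e) = 1" if "e \<in> at v" for e
      proof -
        have "f ` endpoints G e = {a}" using ends_v[OF that] by auto
        then show ?thesis by simp
      qed
      moreover have "card (f ` endpoints G e) = 2" if "e \<in> edges H" for e
        using that multigraph_H endpoints_H[of e] by (auto simp: is_multigraph_def)
      ultimately show ?thesis using edges_H by fastforce
    qed
    have "boundary H X = boundary G (vertices G \<inter> f -` X)"
      using boundary_collapse[OF G multigraph_H * endpoints_H] .
    moreover have "vertices G \<inter> f -` X = (if a \<in> X then X \<union> {v, b} else X)"
      using X vertices_H v V by (auto split: if_splits)
    moreover have "odd (card (X \<union> {v, b}))"
    proof -
      have "finite X" using X(1) multigraph_H by (meson finite_subset is_multigraph_def)
      moreover have "X \<inter> {v, b} = {}" using X(1) vertices_H by auto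
      ultimately have "card (X \<union> {v, b}) = card X + card {v, b}" by (intro card_Un_disjoint) auto
      then show ?thesis using X(2) ne by simp
    qed
    ultimately show ?thesis using rG X vertices_H v V by (auto simp: r_graph_def)
  qed
  ultimately show ?thesis using multigraph_H by (simp add: r_graph_def regular_def)
qed

text \<open>Edges at \<open>v\<close> borrow the colour of a partner edge: \<open>?P\<close> is matched with \<open>?B\<close> and \<open>?Q\<close>
  with \<open>?A\<close>, crosswise, so that an edge between \<open>v\<close> and \<open>a\<close> avoids the colours of the other edges at \<open>a\<close>.\<close>

lemma edge_colorable_from_H:
  assumes "edge_colorable r H"
  shows "edge_colorable r G"
proof -
  obtain c where c: "\<And>e. e \<in> edges H \<Longrightarrow> c e < r"
    "\<And>e f. e \<in> edges H \<Longrightarrow> f \<in> edges H \<Longrightarrow> e \<noteq> f \<Longrightarrow> endpoints H e \<inter> endpoints H f \<noteq> {} \<Longrightarrow> c e \<noteq> (c f :: nat)"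
    using assms unfolding edge_colorable_def by blast
  let ?A = "at a - at v" and ?B = "at b - at v" and ?P = "at v \<inter> at a" and ?Q = "at v \<inter> at b"
  have AB: "?A \<subseteq> edges H" "?B \<subseteq> edges H" using edges_H by auto
  \<comment> \<open>All these edges meet in the merged vertex of \<open>H\<close>.\<close>
  have inj: "inj_on c (?A \<union> ?B)"
  proof (rule inj_onI, rule ccontr)
    fix d e assume *: "d \<in> ?A \<union> ?B" "e \<in> ?A \<union> ?B" "c d = c e" "d \<noteq> e"
    then have "a \<in> endpoints H d" "a \<in> endpoints H e"
      unfolding endpoints_H by (auto simp: image_iff)
    then show False using c(2)[of d e] * AB by blast
  qed
  have "card ?P = card ?B" "card ?Q = card ?A"
    using card_at_v card_at_split[OF V(1)] card_at_split[OF V(2)] by linarith+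
  then obtain g h where "bij_betw g ?P ?B" "bij_betw h ?Q ?A"
    using finite_at by (meson finite_Diff finite_Int finite_same_card_bij)
  then have g: "inj_on g ?P" "\<And>e. e \<in> ?P \<Longrightarrow> g e \<in> ?B"
    and h: "inj_on h ?Q" "\<And>e. e \<in> ?Q \<Longrightarrow> h e \<in> ?A"
    by (auto simp only: bij_betw_def)
  \<comment> \<open>\<open>s\<close> sends an edge to the edge of \<open>H\<close> whose colour it receives.\<close>
  define s where "s e = (if e \<in> ?P then g e else if e \<in> ?Q then h e else e)" for e
  have sP: "s e \<in> ?B" "s e = g e" if "e \<in> ?P" for e using g(2)[OF that] that by (auto simp: s_def)
  have sQ: "s e \<in> ?A" "s e = h e" if "e \<in> ?Q" for e
    using h(2)[OF that] that at_v_split(2) by (auto simp: s_def)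
  have sH: "s e = e" if "e \<in> edges H" for e using that edges_H by (auto simp: s_def)
  have cases: "e \<in> ?P \<or> e \<in> ?Q \<or> e \<in> edges H" if "e \<in> edges G" for e
    using that at_v_split(1) edges_H by blast
  have sE: "s e \<in> edges H" if "e \<in> edges G" for e
    using cases[OF that] sP(1)[of e] sQ(1)[of e] sH[of e] AB by auto
  have PH: "c (s d) \<noteq> c (s e)"
    if d: "d \<in> at v" and e: "e \<in> edges H" and meet: "endpoints G d \<inter> endpoints G e \<noteq> {}" for d e
  proof -
    have vn: "v \<notin> endpoints G e" "e \<in> edges G" using e edges_H by auto
    consider "d \<in> ?P" "endpoints G d = {v, a}" | "d \<in> ?Q" "endpoints G d = {v, b}"
      using ends_v[OF d] d by auto
    then have "s d \<in> ?A \<union> ?B \<and> e \<in> ?A \<union> ?B \<and> s d \<noteq> e"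
    proof cases
      case 1
      then have "e \<in> ?A" using vn meet by auto
      then show ?thesis using sP(1)[OF 1(1)] not_adjacent by blast
    next
      case 2
      then have "e \<in> ?B" using vn meet by auto
      then show ?thesis using sQ(1)[OF 2(1)] not_adjacent by blast
    qed
    then have "c (s d) \<noteq> c e" by (intro inj_on_contraD[OF inj]) blast+
    then show ?thesis using sH[OF e] by simp
  qed
  have disj: "p \<noteq> q" if "p \<in> ?A" "q \<in> ?B" for p q
  proof
    assume "p = q"
    with that have "q \<in> ?A" "q \<in> ?B" by simp_all
    then have "q \<in> ?A \<inter> ?B" by (rule IntI)
    then show False unfolding not_adjacent by (rule emptyE)
  qed
  have PP: "c (s d) \<noteq> c (s e)" if de: "d \<in> at v" "e \<in> at v" "d \<noteq> e" for d e
  proof -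
    have "s d \<in> ?A \<union> ?B" "s e \<in> ?A \<union> ?B"
      using de(1,2) sP(1)[of d] sP(1)[of e] sQ(1)[of d] sQ(1)[of e] at_v_split(1) by blast+
    moreover have "s d \<noteq> s e"
    proof -
      consider "d \<in> ?P" "e \<in> ?P" | "d \<in> ?Q" "e \<in> ?Q" | "d \<in> ?P" "e \<in> ?Q" | "d \<in> ?Q" "e \<in> ?P"
        using de at_v_split(1) by blast
      then show ?thesis
      proof cases
        case 1
        then show ?thesis using inj_on_contraD[OF g(1) de(3)] sP(2) by simp
      next
        case 2
        then show ?thesis using inj_on_contraD[OF h(1) de(3)] sQ(2) by simp
      next
        case 3
        then show ?thesis using disj[OF sQ(1)[OF 3(2)] sP(1)[OF 3(1)]] by simp
      next
        case 4
        then show ?thesis using disj[OF sQ(1)[OF 4(1)] sP(1)[OF 4(2)]] by simp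
      qed
    qed
    ultimately show ?thesis by (intro inj_on_contraD[OF inj])
  qed
  have "c (s d) \<noteq> c (s e)"
    if de: "d \<in> edges G" "e \<in> edges G" "d \<noteq> e" "endpoints G d \<inter> endpoints G e \<noteq> {}" for d e
  proof -
    consider "d \<in> at v" "e \<in> at v" | "d \<in> at v" "e \<in> edges H" | "e \<in> at v" "d \<in> edges H"
      | "d \<in> edges H" "e \<in> edges H"
      using de edges_H by auto
    then show ?thesis
    proof cases
      case 1
      then show ?thesis using PP de(3) by simp
    next
      case 2
      then show ?thesis using PH de(4) by simp
    next
      case 3
      then show ?thesis using PH[of e d] de(4) by (simp add: Int_commute eq_commute)
    next
      case 4
      have "endpoints H d \<inter> endpoints H e \<noteq> {}" using de(4) unfolding endpoints_H by blast
      then show ?thesis using c(2)[OF 4 de(3)] sH 4 by simp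
    qed
  qed
  moreover have "c (s e) < r" if "e \<in> edges G" for e using c(1) sE that by blast
  ultimately show ?thesis
    unfolding edge_colorable_def by (intro exI[of _ "\<lambda>e. c (s e)"]) blast
qed

end

section \<open>Colouring \<open>K\<^sub>4\<close>-minor-free \<open>r\<close>-graphs\<close>

lemma K4_minor_free_r_graph_edge_colorable:
  assumes "r \<ge> 1" "r_graph r G" "K4_minor_free G"
  shows "edge_colorable r G"
  using assms(2,3)
proof (induction "card (vertices G)" arbitrary: G rule: less_induct)
  case less
  have G: "is_multigraph G" using less.prems(1) by (simp add: r_graph_def)
  have finV: "finite (vertices G)" using G by (simp add: is_multigraph_def)
  show ?case
  proof (cases "vertices G = {}")
    case True
    then have "edges G = {}" using G by (fastforce simp: is_multigraph_def)
    then show ?thesis by (simp add: edge_colorable_def)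
  next
    case False
    then obtain v where v: "v \<in> vertices G" "\<not> 3 \<le> card (nbrs G v)"
      using min_degree_3_K4_minor[OF G False] less.prems(2) by blast
    have "card {e \<in> edges G. v \<in> endpoints G e} = r"
      using less.prems(1) v(1) by (simp add: r_graph_def regular_def degree_def)
    then obtain e where "e \<in> edges G" "v \<in> endpoints G e"
      using assms(1) by (metis (mono_tags, lifting) Collect_empty_eq card.empty not_one_le_zero)
    then have "nbrs G v \<noteq> {}" using edge_at[OF G] by blast
    then have "card (nbrs G v) \<noteq> 0" using finite_nbrs[OF G] by simp
    then consider "card (nbrs G v) = 1" | "card (nbrs G v) = 2" using v(2) by linarith
    then show ?thesis
    proof cases
      case 1
      then obtain a where nb: "nbrs G v = {a}" by (auto simp: card_1_singleton_iff)
      have a: "a \<in> vertices G" "a \<noteq> v"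
        using nb nbrs_subset[OF G, of v] nbrs_irrefl[OF G, of v] by auto
      let ?H = "delete_vertex (delete_vertex G v) a"
      have "minor_step G (delete_vertex G v)" using v(1) by (rule minor_step.delete_vertex)
      moreover have "minor_step (delete_vertex G v) ?H"
        using a by (intro minor_step.delete_vertex) (simp add: delete_vertex_def)
      ultimately have "minor_step\<^sup>*\<^sup>* G ?H" by auto
      then have "K4_minor_free ?H" using less.prems(2) K4_minor_free_minor by blast
      moreover have "card (vertices ?H) < card (vertices G)"
        using finV v(1) by (intro psubset_card_mono) (auto simp: delete_vertex_def)
      ultimately have "edge_colorable r ?H"
        using less.hyps r_graph_delete_pair[OF less.prems(1) v(1) a(1) nb] by blast
      then show ?thesis using edge_colorable_add_pair[OF less.prems(1) v(1) a(1) nb] by blast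
    next
      case 2
      then obtain a b where nb: "nbrs G v = {a, b}" "a \<noteq> b" by (auto simp: card_2_iff)
      interpret degree_two_vertex G r v a b
        using less.prems(1) v(1) nb by unfold_locales
      have "card (vertices H) < card (vertices G)"
        unfolding vertices_H using finV v(1) by (intro psubset_card_mono) auto
      then have "edge_colorable r H"
        using less.hyps r_graph_H K4_minor_free_minor[OF less.prems(2) minor_H] by blast
      then show ?thesis by (rule edge_colorable_from_H)
    qed
  qed
qed

theorem theorem6p2:
  fixes G :: "('v, 'e) multigraph" and k :: nat
  assumes "k \<ge> 1"
    and "r_graph (2 * k) G"
    and "K4_minor_free G"
  shows "edge_colorable (2 * k) G"
  using K4_minor_free_r_graph_edge_colorable[of "2 * k" G] assms by simp

end
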